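(* Let $K\subset\mathbb{R}^{n}$ be a self-similar set such that the convex hull $\operatorname{co} K$ is a polytope. Then $K$ has at most countably many critical values.
   Context: Self-similar set: let $\phi_1,\dots,\phi_k$ be contracting similarities of $\mathbb{R}^n$, i.e. $\phi_i(x)=r_iA_ix+v_i$ with $v_i\in\mathbb{R}^n$, $r_i\in(0,1)$ and $A_i$ a linear isometry. There is a unique nonempty compact set $K$ with $K=\bigcup_{i=1}^{k}\phi_i(K)$; sets $K$ of this form are called self-similar. No separation condition is assumed. Critical values: for a closed set $A\subset\mathbb{R}^n$ and $x\in\mathbb{R}^n$ put $N(x)=\{a\in A:\operatorname{dist}(x,A)=|x-a|\}$. The point $x$ is a critical point of $A$ if $x\in\operatorname{co}(N(x))$, and then $\operatorname{dist}(x,A)$ is called a critical value of $A$. *)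

theory Defs
  imports "HOL-Analysis.Analysis"
begin

definition contracting_similarity :: "('a::euclidean_space \<Rightarrow> 'a) \<Rightarrow> bool" where
  "contracting_similarity \<phi> \<longleftrightarrow>
     (\<exists>r A v. 0 < r \<and> r < 1 \<and> orthogonal_transformation A \<and> (\<forall>x. \<phi> x = r *\<^sub>R A x + v))"

text \<open>No separation condition is imposed. The value \<open>k = 0\<close> is excluded automatically,
  because \<open>K\<close> is nonempty.\<close>

definition self_similar :: "'a::euclidean_space set \<Rightarrow> bool" where
  "self_similar K \<longleftrightarrow>
     compact K \<and> K \<noteq> {} \<and>
     (\<exists>(k::nat) \<phi>. (\<forall>i\<in>{1..k}. contracting_similarity (\<phi> i)) \<and> K = (\<Union>i\<in>{1..k}. \<phi> i ` K))"

definition nearest_points :: "'a::euclidean_space set \<Rightarrow> 'a \<Rightarrow> 'a set" where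
  "nearest_points A x = {a \<in> A. infdist x A = dist x a}"

text \<open>Every point \<open>x \<in> A\<close> is critical, since its only nearest point is \<open>x\<close> itself;
  thus \<open>0\<close> counts as a critical value of every nonempty \<open>A\<close>.\<close>

definition critical_point :: "'a::euclidean_space set \<Rightarrow> 'a \<Rightarrow> bool" where
  "critical_point A x \<longleftrightarrow> x \<in> convex hull (nearest_points A x)"

definition critical_values :: "'a::euclidean_space set \<Rightarrow> real set" where
  "critical_values A = {infdist x A | x. critical_point A x}"

end

theory Submission
  imports Defs
begin

text \<open>
Write \<open>P = convex hull K\<close>, and call the images \<open>\<phi>\<^sub>w ` P\<close>, for finite words \<open>w\<close> in the
similarities, the pieces. There are only countably many of them.

Let \<open>x\<close> be critical with distance \<open>d > 0\<close>, and let \<open>a\<close> be one of its nearest points. The open ball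
of radius \<open>d\<close> around \<open>x\<close> misses \<open>K\<close>, so seen from a small piece around \<open>a\<close> it looks almost like
a half-space. The geometric heart of the proof (\<open>nearest_point_supports_piece\<close>) is that because
\<open>P\<close> is a polytope the word "almost" can be dropped: some piece containing \<open>a\<close> lies entirely in
the half-space bounded by the tangent hyperplane of the ball at \<open>a\<close> that does not contain \<open>x\<close>.

This makes the critical values countable. By Caratheodory's theorem \<open>x\<close> is a convex combination
of finitely many nearest points; choose a supported piece for each of them. The finite set of
pieces so obtained determines \<open>d\<close> (\<open>witness_le\<close>): the distance functions to the pieces have at
\<open>x\<close> gradients whose convex hull contains \<open>0\<close>, so \<open>x\<close> minimises their maximum, and \<open>d\<close> is
the minimal value. A countable set has only countably many finite subsets.

For the geometric part follow an address of \<open>a\<close> and pull everything back to \<open>P\<close>. This gives points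
\<open>b n\<close> of \<open>P\<close> and rotated copies \<open>u n\<close> of \<open>x - a\<close>, and the ball condition says that
\<open>u n \<bullet> y\<close> exceeds \<open>u n \<bullet> b n\<close> on \<open>P\<close> by an amount that tends to \<open>0\<close>. It has to be shown that
\<open>b n\<close> maximises \<open>u n\<close> over \<open>P\<close> for some \<open>n\<close>. Among the cluster values of \<open>u\<close> let \<open>l\<close> be one
whose face of maximizers has the least dimension \<open>k\<close>. Start at a time \<open>n\<close> at which \<open>u n\<close> is very close
to \<open>l\<close>, and follow the direction \<open>l\<close>, rather than \<open>u n\<close>, along the address. By minimality of
\<open>k\<close> its faces of maximizers never lose dimension (\<open>faces_persist\<close>); each is then a part of the previous
one spanning the same affine space. Three things follow (\<open>support_attained\<close>). First, the height of the
faces over the points \<open>b m\<close> is scaled up at every step but remains bounded, so it vanishes and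
\<open>b n\<close> lies on the face of \<open>l\<close>. Second, \<open>u n\<close> is constant on that face, because the face
reappears, up to the rotations, whenever \<open>u\<close> returns close to \<open>l\<close>. Third, a small
perturbation of \<open>l\<close> that is constant on the face attains its maximum on the whole face, and \<open>u n\<close> is
such a perturbation.
\<close>

section \<open>Faces on which a linear functional is maximal\<close>

definition maximizers :: "'a::real_inner set \<Rightarrow> 'a \<Rightarrow> 'a set" where
  "maximizers P u = {x \<in> P. \<forall>y\<in>P. u \<bullet> y \<le> u \<bullet> x}"

definition const_on :: "'a::real_inner \<Rightarrow> 'a set \<Rightarrow> bool" where
  "const_on z E \<longleftrightarrow> (\<forall>x\<in>E. \<forall>y\<in>E. z \<bullet> x = z \<bullet> y)"

text \<open>The direction \<open>q\<close> has distance at least \<open>g\<close> from the relative boundary of the normal cone of its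
face of maximizers. The condition speaks of the affine span of the face only, so it is inherited by
subsets of \<open>P\<close> whose face has the same span, and it is unaffected by rescaling \<open>P\<close>. A gap between
the values of \<open>q\<close> on and off the face would have neither property.\<close>

definition stable :: "real \<Rightarrow> 'a::real_inner set \<Rightarrow> 'a \<Rightarrow> bool" where
  "stable g P q \<longleftrightarrow>
     (\<forall>z. norm z \<le> g \<and> const_on z (maximizers P q) \<longrightarrow> maximizers P q \<subseteq> maximizers P (q + z))"

lemma const_onD: "const_on z E \<Longrightarrow> x \<in> E \<Longrightarrow> y \<in> E \<Longrightarrow> z \<bullet> x = z \<bullet> y"
  unfolding const_on_def by blast

lemma maximizersD1: "x \<in> maximizers P u \<Longrightarrow> x \<in> P"
  by (simp add: maximizers_def)

lemma const_on_maximizers: "const_on u (maximizers P u)"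
  unfolding const_on_def
proof (intro ballI)
  fix x y assume "x \<in> maximizers P u" "y \<in> maximizers P u"
  then show "u \<bullet> x = u \<bullet> y" by (intro order_antisym) (auto simp: maximizers_def)
qed

lemma maximizers_eq_Int:
  assumes "e \<in> maximizers P u"
  shows "maximizers P u = P \<inter> {x. u \<bullet> x = u \<bullet> e}"
proof
  show "maximizers P u \<subseteq> P \<inter> {x. u \<bullet> x = u \<bullet> e}"
    using const_onD[OF const_on_maximizers _ assms] by (blast dest: maximizersD1)
  show "P \<inter> {x. u \<bullet> x = u \<bullet> e} \<subseteq> maximizers P u"
    using assms by (auto simp: maximizers_def)
qed

lemma maximizers_nonempty:
  assumes "compact P" "P \<noteq> {}"
  shows "maximizers P u \<noteq> {}"
proof -
  have "\<exists>x\<in>P. \<forall>y\<in>P. u \<bullet> y \<le> u \<bullet> x"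
    by (intro continuous_attains_sup assms continuous_intros)
  then show ?thesis by (auto simp: maximizers_def)
qed

lemma maximizers_face_of:
  fixes P :: "'a::euclidean_space set"
  assumes "convex P"
  shows "maximizers P u face_of P"
proof (cases "maximizers P u = {}")
  case True
  then show ?thesis by simp
next
  case False
  then obtain e where e: "e \<in> maximizers P u" by blast
  show ?thesis unfolding maximizers_eq_Int[OF e]
    by (rule face_of_Int_supporting_hyperplane_le) (use assms e in \<open>auto simp: maximizers_def\<close>)
qed

lemma maximizers_subset:
  assumes "P' \<subseteq> P" "maximizers P u \<inter> P' \<noteq> {}"
  shows "maximizers P' u = maximizers P u \<inter> P'"
proof -
  obtain e where e: "e \<in> maximizers P u" "e \<in> P'" using assms(2) by blast
  have "u \<bullet> x = u \<bullet> e" if "x \<in> maximizers P' u" for x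
    using e that assms(1) by (intro order_antisym) (auto simp: maximizers_def)
  then show ?thesis using e assms(1) by (auto simp: maximizers_def)
qed

lemma polytope_vertex_gap:
  fixes P :: "'a::euclidean_space set"
  assumes "polytope P"
  obtains V \<gamma> where "finite V" "P = convex hull V" "\<gamma> > 0"
    "\<And>v e. v \<in> V - maximizers P u \<Longrightarrow> e \<in> maximizers P u \<Longrightarrow> \<gamma> \<le> u \<bullet> (e - v)"
proof -
  obtain V where V: "finite V" "P = convex hull V"
    using assms by (auto simp: polytope_def)
  show ?thesis
  proof (cases "maximizers P u = {} \<or> V - maximizers P u = {}")
    case True
    then show ?thesis using that[OF V zero_less_one] by blast
  next
    case False
    then obtain e where e: "e \<in> maximizers P u" by blast
    define X where "X = (\<lambda>v. u \<bullet> (e - v)) ` (V - maximizers P u)"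
    have X: "finite X" "X \<noteq> {}" using V False by (auto simp: X_def)
    have pos: "0 < u \<bullet> (e - v)" if v: "v \<in> V - maximizers P u" for v
    proof -
      have "v \<in> P" using v V(2) by (simp add: hull_inc)
      then obtain y where "y \<in> P" "u \<bullet> v < u \<bullet> y" using v by (auto simp: maximizers_def not_le)
      moreover have "u \<bullet> y \<le> u \<bullet> e" using e \<open>y \<in> P\<close> by (simp add: maximizers_def)
      ultimately show ?thesis by (simp add: inner_diff_right)
    qed
    have "0 < Min X" using X pos by (auto simp: X_def)
    moreover have "Min X \<le> u \<bullet> (e' - v)" if "v \<in> V - maximizers P u" "e' \<in> maximizers P u" for v e'
    proof -
      have "u \<bullet> e' = u \<bullet> e"
        using const_onD[OF const_on_maximizers] e that by blast
      then have "u \<bullet> (e' - v) \<in> X" using that by (auto simp: X_def inner_diff_right)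
      then show ?thesis using X by simp
    qed
    ultimately show ?thesis using that[OF V] by blast
  qed
qed

lemma bounded_norm_diff_le:
  fixes P :: "'a::real_normed_vector set"
  assumes "bounded P"
  obtains D where "D > 0" "\<And>x y. x \<in> P \<Longrightarrow> y \<in> P \<Longrightarrow> norm (x - y) \<le> D"
proof -
  obtain B where B: "B > 0" "\<And>x. x \<in> P \<Longrightarrow> norm x \<le> B"
    using assms by (auto simp: bounded_pos)
  have "norm (x - y) \<le> 2 * B" if "x \<in> P" "y \<in> P" for x y
    using norm_triangle_ineq4[of x y] B(2)[OF that(1)] B(2)[OF that(2)] by linarith
  then show ?thesis using that[of "2 * B"] B(1) by simp
qed

text \<open>Off the face, the values of \<open>u\<close> at the vertices lie below the maximum by a fixed gap, which a
perturbation of size gap over diameter cannot close.\<close>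

lemma polytope_stable:
  fixes P :: "'a::euclidean_space set"
  assumes "polytope P"
  shows "\<exists>g>0. stable g P u"
proof -
  obtain V \<gamma> where V: "finite V" "P = convex hull V" "\<gamma> > 0"
    "\<And>v e. v \<in> V - maximizers P u \<Longrightarrow> e \<in> maximizers P u \<Longrightarrow> \<gamma> \<le> u \<bullet> (e - v)"
    using polytope_vertex_gap[OF assms] by blast
  have "bounded P" using assms polytope_imp_bounded by blast
  then obtain D where D: "D > 0" "\<And>x y. x \<in> P \<Longrightarrow> y \<in> P \<Longrightarrow> norm (x - y) \<le> D"
    using bounded_norm_diff_le by blast
  have "stable (\<gamma> / D) P u"
    unfolding stable_def
  proof (intro allI impI subsetI)
    fix z e assume z: "norm z \<le> \<gamma> / D \<and> const_on z (maximizers P u)" and e: "e \<in> maximizers P u"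
    have eP: "e \<in> P" using e by (simp add: maximizers_def)
    have "V \<subseteq> {y. (u + z) \<bullet> y \<le> (u + z) \<bullet> e}"
    proof
      fix v assume v: "v \<in> V"
      then have vP: "v \<in> P" using V(2) by (simp add: hull_inc)
      show "v \<in> {y. (u + z) \<bullet> y \<le> (u + z) \<bullet> e}"
      proof (cases "v \<in> maximizers P u")
        case True
        then show ?thesis
          using const_onD[OF const_on_maximizers True e] const_onD[OF conjunct2[OF z] True e]
          by (simp add: inner_add_left)
      next
        case False
        then have "\<gamma> \<le> u \<bullet> (e - v)" using V(4)[of v e] v e by simp
        moreover have "\<bar>z \<bullet> (e - v)\<bar> \<le> (\<gamma> / D) * D"
          using z D(2)[OF eP vP] D(1)
          by (intro order_trans[OF Cauchy_Schwarz_ineq2] mult_mono) (use V(3) in auto)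
        ultimately show ?thesis using D by (simp add: inner_add_left inner_diff_right)
      qed
    qed
    then have "P \<subseteq> {y. (u + z) \<bullet> y \<le> (u + z) \<bullet> e}"
      unfolding V(2) by (rule hull_minimal) (rule convex_halfspace_le)
    then show "e \<in> maximizers P (u + z)" using eP by (auto simp: maximizers_def)
  qed
  then show ?thesis using V(3) D(1) by (meson divide_pos_pos)
qed

text \<open>The face of \<open>s\<close> is the hull of the vertices that it contains, and by the gap a vertex off the face
of \<open>u\<close> cannot become maximal under a small change of direction.\<close>

lemma polytope_maximizers_upper_semicontinuous:
  fixes P :: "'a::euclidean_space set"
  assumes "polytope P" "P \<noteq> {}"
  obtains \<epsilon> where "\<epsilon> > 0" "\<And>s. norm (s - u) < \<epsilon> \<Longrightarrow> maximizers P s \<subseteq> maximizers P u"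
proof -
  obtain V \<gamma> where V: "finite V" "P = convex hull V" "\<gamma> > 0"
    "\<And>v e. v \<in> V - maximizers P u \<Longrightarrow> e \<in> maximizers P u \<Longrightarrow> \<gamma> \<le> u \<bullet> (e - v)"
    using polytope_vertex_gap[OF assms(1)] by blast
  have P: "convex P" "compact P" "bounded P"
    using assms(1) polytope_imp_convex polytope_imp_compact polytope_imp_bounded by auto
  then obtain D where D: "D > 0" "\<And>x y. x \<in> P \<Longrightarrow> y \<in> P \<Longrightarrow> norm (x - y) \<le> D"
    using bounded_norm_diff_le by blast
  obtain e where e: "e \<in> maximizers P u"
    using maximizers_nonempty P assms by blast
  have "maximizers P s \<subseteq> maximizers P u" if s: "norm (s - u) < \<gamma> / D" for s
  proof -
    have "maximizers P s face_of convex hull V"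
      using maximizers_face_of[OF P(1), of s] V(2) by simp
    from face_of_convex_hull_subset[OF finite_imp_compact[OF V(1)] this]
    obtain T where T: "T \<subseteq> V" "maximizers P s = convex hull T"
      by blast
    have "t \<in> maximizers P u" if t: "t \<in> T" for t
    proof (rule ccontr)
      assume "t \<notin> maximizers P u"
      then have "\<gamma> \<le> u \<bullet> (e - t)" using V(4)[of t e] T(1) t e by blast
      moreover have tP: "t \<in> maximizers P s" using T(2) t by (simp add: hull_inc)
      moreover have "0 \<le> s \<bullet> (t - e)" using tP e by (simp add: maximizers_def inner_diff_right)
      moreover have "\<bar>(s - u) \<bullet> (t - e)\<bar> \<le> norm (s - u) * D"
        using D(2)[of t e] tP e
        by (intro order_trans[OF Cauchy_Schwarz_ineq2] mult_left_mono) (auto simp: maximizers_def)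
      moreover have "norm (s - u) * D < \<gamma>" using s D(1) by (simp add: field_simps)
      ultimately show False by (simp add: inner_diff_left inner_diff_right)
    qed
    moreover have "convex (maximizers P u)"
      using maximizers_face_of[OF P(1)] face_of_imp_convex by blast
    ultimately show ?thesis unfolding T(2) by (intro hull_minimal subsetI) auto
  qed
  then show ?thesis using that[of "\<gamma> / D"] V(3) D(1) by auto
qed

text \<open>Being constant depends on the affine span only, and \<open>E'\<close> and \<open>E\<close> have the same one.\<close>

lemma const_on_aff_dim_eq:
  fixes E :: "'a::euclidean_space set"
  assumes "E' \<subseteq> E" "aff_dim E' = aff_dim E" "E' \<noteq> {}" "const_on z E'"
  shows "const_on z E"
proof -
  obtain e where e: "e \<in> E'" using assms by blast
  have "affine hull E' = affine hull E"
    by (rule affine_dim_equal) (use assms in \<open>auto simp: hull_mono\<close>)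
  moreover have "affine hull E' \<subseteq> {x. z \<bullet> x = z \<bullet> e}"
    by (rule hull_minimal) (use const_onD[OF assms(4) _ e] in \<open>blast intro: affine_hyperplane\<close>)+
  ultimately have "E \<subseteq> {x. z \<bullet> x = z \<bullet> e}" by (metis hull_subset order_trans)
  then have "z \<bullet> x = z \<bullet> e" if "x \<in> E" for x using that by blast
  then show ?thesis by (simp add: const_on_def)
qed

text \<open>Equal dimension makes the two faces span the same affine space, so the same perturbations are
admissible for both.\<close>

lemma stable_subset:
  fixes P :: "'a::euclidean_space set"
  assumes "P' \<subseteq> P" "maximizers P q \<inter> P' \<noteq> {}"
    "aff_dim (maximizers P' q) = aff_dim (maximizers P q)" "stable g P q"
  shows "stable g P' q"
  unfolding stable_def
proof (intro allI impI subsetI)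
  fix z e assume z: "norm z \<le> g \<and> const_on z (maximizers P' q)" and e: "e \<in> maximizers P' q"
  note eq = maximizers_subset[OF assms(1,2)]
  have "const_on z (maximizers P q)"
    by (rule const_on_aff_dim_eq[OF _ assms(3)]) (use z e in \<open>auto simp: eq\<close>)
  then have "maximizers P q \<subseteq> maximizers P (q + z)" using assms(4) z unfolding stable_def by blast
  then have "e \<in> maximizers P (q + z)" "e \<in> P'" using e by (auto simp: eq)
  then show "e \<in> maximizers P' (q + z)" using assms(1) by (auto simp: maximizers_def)
qed

text \<open>The uniform bound \<open>g\<close> prevents the face from growing in the limit: moving away from its affine
span costs at least a fixed multiple of the distance, and this survives the limit.\<close>

lemma maximizers_stable_limit:
  fixes P :: "'a::euclidean_space set"
  assumes g: "g > 0" and F: "\<And>j. maximizers P (s j) = F" "F \<noteq> {}"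
    and st: "\<And>j. stable g P (s j)" and lim: "s \<longlonglongrightarrow> l"
  shows "maximizers P l = F"
proof -
  obtain f where f: "f \<in> F" using F by blast
  have fP: "f \<in> P" using f F(1)[of 0] by (auto simp: maximizers_def)
  have lims: "(\<lambda>j. s j \<bullet> x) \<longlonglongrightarrow> l \<bullet> x" for x by (intro tendsto_intros lim)
  show ?thesis
  proof
    show "F \<subseteq> maximizers P l"
    proof
      fix x assume x: "x \<in> F"
      have "l \<bullet> y \<le> l \<bullet> x" if "y \<in> P" for y
        by (rule LIMSEQ_le[OF lims lims]) (use x F(1) that in \<open>fastforce simp: maximizers_def\<close>)
      then show "x \<in> maximizers P l" using x F(1)[of 0] by (auto simp: maximizers_def)
    qed
    show "maximizers P l \<subseteq> F"
    proof (rule ccontr)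
      assume "\<not> ?thesis"
      then obtain x where x: "x \<in> maximizers P l" "x \<notin> F" by blast
      have xP: "x \<in> P" using x by (simp add: maximizers_def)
      obtain y z where yz: "y \<in> span ((\<lambda>t. t - f) ` F)" "\<And>t. t \<in> span ((\<lambda>t. t - f) ` F) \<Longrightarrow> orthogonal z t"
        "x - f = y + z"
        using orthogonal_subspace_decomp_exists by blast
      have cz: "const_on z F"
      proof -
        have "z \<bullet> t = z \<bullet> f" if "t \<in> F" for t
          using yz(2)[of "t - f"] that by (auto simp: orthogonal_def inner_diff_right span_base)
        then show ?thesis by (simp add: const_on_def)
      qed
      have zz: "z \<bullet> (x - f) = z \<bullet> z"
        using yz by (simp add: orthogonal_def inner_add_right)
      have "z \<noteq> 0"
      proof
        assume "z = 0"
        then have "x - f \<in> span ((\<lambda>t. t - f) ` F)" using yz by simp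
        moreover have "orthogonal (s 0) t" if t: "t \<in> (\<lambda>t. t - f) ` F" for t
        proof -
          obtain e where e: "e \<in> F" "t = e - f" using t by blast
          have "s 0 \<bullet> e = s 0 \<bullet> f"
            using const_on_maximizers[of "s 0" P] e(1) f unfolding F(1) by (rule const_onD)
          then show ?thesis by (simp add: e(2) orthogonal_def inner_diff_right)
        qed
        ultimately have "orthogonal (s 0) (x - f)" using orthogonal_to_span by blast
        then have "s 0 \<bullet> x = s 0 \<bullet> f" by (simp add: orthogonal_def inner_diff_right)
        moreover have "f \<in> maximizers P (s 0)" using f F(1) by simp
        ultimately have "x \<in> maximizers P (s 0)" using xP by (simp add: maximizers_def)
        then show False using x F(1) by blast
      qed
      \<comment> \<open>The admissible perturbation of length \<open>g\<close> pointing from the face towards \<open>x\<close>.\<close>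
      define z' where "z' = (g / norm z) *\<^sub>R z"
      have z': "norm z' \<le> g" "z' \<bullet> (x - f) > 0"
        using \<open>z \<noteq> 0\<close> g zz by (auto simp: z'_def)
      have z'_const: "const_on z' F"
        unfolding const_on_def
      proof (intro ballI)
        fix t t' assume "t \<in> F" "t' \<in> F"
        then have "z \<bullet> t = z \<bullet> t'" by (rule const_onD[OF cz])
        then show "z' \<bullet> t = z' \<bullet> t'" by (simp add: z'_def)
      qed
      have "z' \<bullet> (x - f) \<le> s j \<bullet> f - s j \<bullet> x" for j
      proof -
        have "f \<in> maximizers P (s j + z')"
          using st[of j] z'(1) z'_const f unfolding stable_def F(1) by blast
        then have "(s j + z') \<bullet> x \<le> (s j + z') \<bullet> f" using xP by (simp add: maximizers_def)
        then show ?thesis by (simp add: inner_add_left inner_diff_right)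
      qed
      then have "z' \<bullet> (x - f) \<le> l \<bullet> f - l \<bullet> x"
        by (intro LIMSEQ_le_const[OF tendsto_diff[OF lims lims]]) auto
      moreover have "l \<bullet> f \<le> l \<bullet> x" using x(1) fP by (simp add: maximizers_def)
      ultimately show False using z'(2) by linarith
    qed
  qed
qed

lemma maximizers_similarity:
  assumes "r > 0" "orthogonal_transformation A"
  shows "maximizers ((\<lambda>x. r *\<^sub>R A x + v) ` P) (A u) = (\<lambda>x. r *\<^sub>R A x + v) ` maximizers P u"
proof -
  have "A u \<bullet> (r *\<^sub>R A x + v) = r * (u \<bullet> x) + A u \<bullet> v" for x
    using assms(2) by (simp add: inner_add_right orthogonal_transformation_def)
  then have "A u \<bullet> (r *\<^sub>R A x + v) \<le> A u \<bullet> (r *\<^sub>R A y + v) \<longleftrightarrow> u \<bullet> x \<le> u \<bullet> y" for x y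
    using assms(1) by simp
  then show ?thesis by (auto simp: maximizers_def)
qed

lemma const_on_similarity:
  assumes "r > 0" "orthogonal_transformation A"
  shows "const_on (A z) ((\<lambda>x. r *\<^sub>R A x + v) ` E) \<longleftrightarrow> const_on z E"
proof -
  have "A z \<bullet> (r *\<^sub>R A x + v) = r * (z \<bullet> x) + A z \<bullet> v" for x
    using assms(2) by (simp add: inner_add_right orthogonal_transformation_def)
  then have "A z \<bullet> (r *\<^sub>R A x + v) = A z \<bullet> (r *\<^sub>R A y + v) \<longleftrightarrow> z \<bullet> x = z \<bullet> y" for x y
    using assms(1) by simp
  then show ?thesis by (simp add: const_on_def)
qed

lemma aff_dim_similarity:
  fixes A :: "'a::euclidean_space \<Rightarrow> 'a"
  assumes "r > 0" "orthogonal_transformation A"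
  shows "aff_dim ((\<lambda>x. r *\<^sub>R A x + v) ` E) = aff_dim E"
proof -
  have lin: "linear (\<lambda>x. r *\<^sub>R A x)"
    using assms orthogonal_transformation_linear linear_compose_scale_right by blast
  have inj: "inj (\<lambda>x. r *\<^sub>R A x)"
    using assms orthogonal_transformation_inj[OF assms(2)] by (auto simp: inj_def)
  have "(\<lambda>x. r *\<^sub>R A x + v) ` E = (\<lambda>x. v + x) ` ((\<lambda>x. r *\<^sub>R A x) ` E)"
    by (auto simp: image_image add.commute)
  then show ?thesis
    using aff_dim_injective_linear_image[OF lin inj] by (simp add: aff_dim_translation_eq)
qed

lemma stable_similarity:
  assumes "r > 0" "orthogonal_transformation A"
    and "stable g ((\<lambda>x. r *\<^sub>R A x + v) ` P) (A u)"
  shows "stable g P u"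
  unfolding stable_def
proof (intro allI impI)
  fix z assume z: "norm z \<le> g \<and> const_on z (maximizers P u)"
  let ?f = "\<lambda>x. r *\<^sub>R A x + v"
  have "A u + A z = A (u + z)"
    using assms(2) by (simp add: linear_add orthogonal_transformation_linear)
  moreover have "norm (A z) \<le> g" using z orthogonal_transformation_norm[OF assms(2)] by simp
  moreover have "const_on (A z) (maximizers (?f ` P) (A u))"
    unfolding maximizers_similarity[OF assms(1,2)] const_on_similarity[OF assms(1,2)] using z by blast
  ultimately have "maximizers (?f ` P) (A u) \<subseteq> maximizers (?f ` P) (A (u + z))"
    using assms(3) unfolding stable_def by metis
  then have "?f ` maximizers P u \<subseteq> ?f ` maximizers P (u + z)"
    unfolding maximizers_similarity[OF assms(1,2)] .
  moreover have "inj ?f"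
    using assms(1) orthogonal_transformation_inj[OF assms(2)] by (auto simp: inj_def)
  ultimately show "maximizers P u \<subseteq> maximizers P (u + z)" by (simp add: inj_image_subset_iff)
qed

section \<open>Zooming in along an address\<close>

definition cluster_value :: "(nat \<Rightarrow> 'a::topological_space) \<Rightarrow> 'a \<Rightarrow> bool" where
  "cluster_value u l \<longleftrightarrow> (\<exists>N. filterlim N at_top sequentially \<and> (\<lambda>j. u (N j)) \<longlonglongrightarrow> l)"

text \<open>The sequences \<open>b\<close> and \<open>u\<close> are the views of a fixed point and a fixed direction from the nested
pieces with address \<open>w\<close>, each piece being rescaled to \<open>P\<close>. The uniform bound \<open>\<rho>\<close> makes
lengths grow geometrically when zooming in.\<close>

locale similarity_orbit =
  fixes P :: "'a::euclidean_space set" and I :: "'i set" and r :: "'i \<Rightarrow> real"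
    and A :: "'i \<Rightarrow> 'a \<Rightarrow> 'a" and v :: "'i \<Rightarrow> 'a" and \<rho> :: real
    and w :: "nat \<Rightarrow> 'i" and b u :: "nat \<Rightarrow> 'a"
  assumes polytope: "polytope P" and finite_I: "finite I"
    and r_pos: "i \<in> I \<Longrightarrow> 0 < r i" and r_le: "i \<in> I \<Longrightarrow> r i \<le> \<rho>" and rho_less: "\<rho> < 1"
    and orth: "i \<in> I \<Longrightarrow> orthogonal_transformation (A i)"
    and sub: "i \<in> I \<Longrightarrow> (\<lambda>x. r i *\<^sub>R A i x + v i) ` P \<subseteq> P"
    and w: "w n \<in> I"
    and b_in: "b n \<in> P" and b_step: "b n = r (w n) *\<^sub>R A (w n) (b (Suc n)) + v (w n)"
    and u_step: "u n = A (w n) (u (Suc n))"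
    and vanishing: "\<epsilon> > 0 \<Longrightarrow> \<exists>N. \<forall>n\<ge>N. \<forall>y\<in>P. u n \<bullet> (y - b n) \<le> \<epsilon>"
begin

abbreviation \<phi> :: "'i \<Rightarrow> 'a \<Rightarrow> 'a" where
  "\<phi> i \<equiv> \<lambda>x. r i *\<^sub>R A i x + v i"

lemma P_facts: "convex P" "compact P" "P \<noteq> {}" "bounded P"
  using polytope polytope_imp_convex polytope_imp_compact polytope_imp_bounded b_in by auto

lemma A_inv [simp]: "i \<in> I \<Longrightarrow> A i (inv (A i) x) = x"
  using orth orthogonal_transformation_surj surj_f_inv_f by metis

lemma A_inner [simp]: "i \<in> I \<Longrightarrow> A i x \<bullet> A i y = x \<bullet> y"
  using orth by (simp add: orthogonal_transformation_def)

lemma A_diff: "i \<in> I \<Longrightarrow> A i (x - y) = A i x - A i y"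
  using orth by (simp add: linear_diff orthogonal_transformation_linear)

lemma A_norm [simp]: "i \<in> I \<Longrightarrow> norm (A i x) = norm x"
  using orth orthogonal_transformation_norm by blast

lemma norm_u: "norm (u n) = norm (u 0)"
  by (induction n) (metis A_norm u_step w)+

text \<open>A compactness argument: if the claim failed at arbitrarily late times, directions \<open>s\<close> where it fails
would subconverge to a cluster value \<open>l\<close> of \<open>u\<close>, with the map \<open>\<phi> i\<close> and the face
\<open>F\<close> constant along the subsequence. Stability keeps \<open>F\<close> the face of \<open>l\<close>, and by
\<open>vanishing\<close> the limit of the points \<open>b\<close> lies on \<open>F\<close> and in \<open>\<phi> i ` P\<close>. Hence \<open>F \<inter> \<phi> i ` P\<close>
is the image of the face of the next direction, again a cluster value of \<open>u\<close>, so its dimension is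
not below \<open>k\<close>; being a part of \<open>F\<close>, it cannot have a larger one.\<close>

lemma faces_persist:
  assumes min: "\<And>l. cluster_value u l \<Longrightarrow> k \<le> aff_dim (maximizers P l)" and g: "g > 0"
  shows "\<exists>\<epsilon>>0. \<exists>N. \<forall>n\<ge>N. \<forall>s. norm (s - u n) \<le> \<epsilon> \<and> aff_dim (maximizers P s) = k \<and> stable g P s \<longrightarrow>
      maximizers P s \<inter> \<phi> (w n) ` P \<noteq> {} \<and> aff_dim (maximizers (\<phi> (w n) ` P) s) = k"
proof (rule ccontr)
  assume contra: "\<not> ?thesis"
  define bad where "bad n s \<longleftrightarrow> aff_dim (maximizers P s) = k \<and> stable g P s \<and>
    \<not> (maximizers P s \<inter> \<phi> (w n) ` P \<noteq> {} \<and> aff_dim (maximizers (\<phi> (w n) ` P) s) = k)" for n s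
  have "\<exists>n s. n \<ge> j \<and> norm (s - u n) \<le> inverse (real (Suc j)) \<and> bad n s" for j
  proof -
    have "inverse (real (Suc j)) > 0" by simp
    then show ?thesis using contra unfolding bad_def by meson
  qed
  then obtain n s where ns: "\<And>j. n j \<ge> j" "\<And>j. norm (s j - u (n j)) \<le> inverse (real (Suc j))"
    "\<And>j. bad (n j) (s j)" by metis
  \<comment> \<open>There are finitely many maps and faces, so both may be taken constant.\<close>
  define T where "T j = (w (n j), maximizers P (s j))" for j
  have "range T \<subseteq> I \<times> {F. F face_of P}"
    using w maximizers_face_of P_facts by (auto simp: T_def)
  then have "finite (range T)"
    using finite_I finite_polytope_faces[OF polytope] finite_subset by blast
  then obtain j0 where "infinite {j. T j = T j0}"
    using pigeonhole_infinite[of UNIV T] by auto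
  then obtain r1 :: "nat \<Rightarrow> nat" where r1: "strict_mono r1" "\<And>j. T (r1 j) = T j0"
    using infinite_enumerate[of "{j. T j = T j0}"] by auto
  define i where "i = w (n j0)"
  define F where "F = maximizers P (s j0)"
  have i: "i \<in> I" using w by (simp add: i_def)
  have F_ne: "F \<noteq> {}" using maximizers_nonempty P_facts by (simp add: F_def)
  define C where "C = cball (0::'a) (norm (u 0)) \<times> P"
  have "compact C" unfolding C_def by (intro compact_Times compact_cball P_facts)
  moreover have "(u (n (r1 j)), b (n (r1 j))) \<in> C" for j
    using b_in norm_u[of "n (r1 j)"] by (simp add: C_def)
  ultimately obtain lb r2 where r2: "strict_mono r2"
    "((\<lambda>j. (u (n (r1 j)), b (n (r1 j)))) \<circ> r2) \<longlonglongrightarrow> lb"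
    using seq_compactE[of C "\<lambda>j. (u (n (r1 j)), b (n (r1 j)))"] compact_imp_seq_compact by metis
  define q where "q = r1 \<circ> r2"
  obtain l c where lb: "lb = (l, c)" by fastforce
  have q: "strict_mono q" using r1 r2 by (simp add: q_def strict_mono_o)
  have ul: "(\<lambda>j. u (n (q j))) \<longlonglongrightarrow> l" and bc: "(\<lambda>j. b (n (q j))) \<longlonglongrightarrow> c"
    using tendsto_fst[OF r2(2)] tendsto_snd[OF r2(2)] by (simp_all add: q_def lb o_def)
  have wq: "w (n (q j)) = i" and Fq: "maximizers P (s (q j)) = F" for j
    using r1(2)[of "r2 j"] by (simp_all add: T_def i_def F_def q_def)
  have n_top: "filterlim n at_top sequentially"
    by (rule filterlim_at_top_mono[OF filterlim_ident]) (use ns(1) in auto)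
  have q_top: "filterlim q at_top sequentially" using q by (rule filterlim_subseq)
  have nq_top: "filterlim (\<lambda>j. n (q j)) at_top sequentially"
    using filterlim_compose[OF n_top q_top] .
  have sl: "(\<lambda>j. s (q j)) \<longlonglongrightarrow> l"
  proof -
    have "(\<lambda>j. s j - u (n j)) \<longlonglongrightarrow> 0"
      by (rule Lim_null_comparison[OF _ LIMSEQ_inverse_real_of_nat]) (use ns(2) in auto)
    then have "(\<lambda>j. s (q j) - u (n (q j))) \<longlonglongrightarrow> 0" using q_top filterlim_compose by blast
    from tendsto_add[OF this ul] show ?thesis by simp
  qed
  have Fl: "maximizers P l = F"
    by (rule maximizers_stable_limit[OF g Fq F_ne _ sl]) (use ns(3) in \<open>auto simp: bad_def\<close>)
  have c_P: "c \<in> P"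
    using closed_sequentially[OF compact_imp_closed[OF P_facts(2)] b_in bc] .
  have c_i: "c \<in> \<phi> i ` P"
  proof -
    have "compact (\<phi> i ` P)"
      using orth[OF i] P_facts(2)
      by (intro compact_continuous_image continuous_intros linear_continuous_on_compose[OF continuous_on_id])
        (auto simp: orthogonal_transformation_linear)
    moreover have "b (n (q j)) \<in> \<phi> i ` P" for j
      using b_step[of "n (q j)"] b_in wq by auto
    ultimately show ?thesis using closed_sequentially[OF compact_imp_closed _ bc] by blast
  qed
  have "l \<bullet> y \<le> l \<bullet> c" if y: "y \<in> P" for y
  proof -
    have lim: "(\<lambda>j. u (n (q j)) \<bullet> (y - b (n (q j)))) \<longlonglongrightarrow> l \<bullet> (y - c)"
      by (intro tendsto_intros ul bc)
    have "l \<bullet> (y - c) \<le> 0 + \<epsilon>" if eps: "\<epsilon> > 0" for \<epsilon>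
    proof (rule tendsto_upperbound[OF lim])
      obtain N where N: "\<forall>n\<ge>N. \<forall>y\<in>P. u n \<bullet> (y - b n) \<le> \<epsilon>" using vanishing[OF eps] by blast
      have "\<forall>\<^sub>F j in sequentially. N \<le> n (q j)" using nq_top by (simp add: filterlim_at_top)
      then show "\<forall>\<^sub>F j in sequentially. u (n (q j)) \<bullet> (y - b (n (q j))) \<le> 0 + \<epsilon>"
        by (rule eventually_mono) (use N y in auto)
    qed simp
    then have "l \<bullet> (y - c) \<le> 0" by (rule field_le_epsilon)
    then show ?thesis by (simp add: inner_diff_right)
  qed
  then have c_F: "c \<in> F" using c_P Fl by (auto simp: maximizers_def)
  then have meet: "F \<inter> \<phi> i ` P \<noteq> {}" using c_i by blast
  define y where "y = inv (A i) l"
  have Ay: "A i y = l" using i by (simp add: y_def)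
  have "(\<lambda>j. u (Suc (n (q j)))) \<longlonglongrightarrow> y"
  proof -
    have lin: "linear (inv (A i))"
      using orth[OF i] orthogonal_transformation_inv orthogonal_transformation_linear by blast
    have "inv (A i) (u (n (q j))) = u (Suc (n (q j)))" for j
      using u_step[of "n (q j)"] wq orthogonal_transformation_inj[OF orth[OF i]] by (simp add: inv_f_f)
    then show ?thesis
      using bounded_linear.tendsto[OF _ ul, of "inv (A i)"] lin
      by (simp add: linear_conv_bounded_linear y_def)
  qed
  moreover have "filterlim (\<lambda>j. Suc (n (q j))) at_top sequentially"
    using filterlim_compose[OF filterlim_Suc nq_top] .
  ultimately have "cluster_value u y" unfolding cluster_value_def by blast
  then have ky: "k \<le> aff_dim (maximizers P y)" by (rule min)
  have "maximizers (\<phi> i ` P) l = F \<inter> \<phi> i ` P"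
    using maximizers_subset[OF sub[OF i], of l] Fl meet by simp
  moreover have "aff_dim (maximizers (\<phi> i ` P) l) = aff_dim (maximizers P y)"
    using maximizers_similarity[OF r_pos[OF i] orth[OF i], of "v i" P y]
      aff_dim_similarity[OF r_pos[OF i] orth[OF i]] by (simp add: Ay)
  ultimately have "k \<le> aff_dim (F \<inter> \<phi> i ` P)" using ky by simp
  moreover have "aff_dim (F \<inter> \<phi> i ` P) \<le> aff_dim F" by (intro aff_dim_subset) blast
  moreover have "aff_dim F = k" using ns(3)[of j0] by (simp add: bad_def F_def)
  moreover have "maximizers (\<phi> i ` P) (s (q 0)) = F \<inter> \<phi> i ` P"
    using maximizers_subset[OF sub[OF i], of "s (q 0)"] Fq meet by simp
  ultimately have "\<not> bad (n (q 0)) (s (q 0))"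
    using meet by (simp add: bad_def wq Fq)
  then show False using ns(3) by blast
qed

lemma ex_minimal_cluster_value:
  obtains l where "cluster_value u l"
    "\<And>l'. cluster_value u l' \<Longrightarrow> aff_dim (maximizers P l) \<le> aff_dim (maximizers P l')"
proof -
  have "u n \<in> cball 0 (norm (u 0))" for n using norm_u[of n] by simp
  then obtain l q where "strict_mono q" "(u \<circ> q) \<longlonglongrightarrow> l"
    using seq_compactE[of "cball 0 (norm (u 0))" u] compact_imp_seq_compact[OF compact_cball] by metis
  then have "cluster_value u l"
    unfolding cluster_value_def o_def using filterlim_subseq by blast
  then obtain l where l: "cluster_value u l"
    "\<And>l'. cluster_value u l' \<Longrightarrow> nat (aff_dim (maximizers P l)) \<le> nat (aff_dim (maximizers P l'))"
    using ex_has_least_nat[of "cluster_value u" l "\<lambda>l. nat (aff_dim (maximizers P l))"] by metis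
  have "0 \<le> aff_dim (maximizers P l')" for l'
    using maximizers_nonempty[OF P_facts(2,3), of l'] aff_dim_geq[of "maximizers P l'"]
      aff_dim_empty[of "maximizers P l'"] by linarith
  then show ?thesis using that[OF l(1)] l(2) by (metis nat_le_eq_zle nle_le)
qed

text \<open>The direction \<open>l\<close> is carried along as the sequence \<open>s\<close>, which keeps its distance from \<open>u\<close>
because the maps are isometries up to scaling; so \<open>faces_persist\<close> applies at every step.\<close>

lemma support_attained: "\<exists>n. b n \<in> maximizers P (u n)"
proof -
  obtain l where l: "cluster_value u l"
    "\<And>l'. cluster_value u l' \<Longrightarrow> aff_dim (maximizers P l) \<le> aff_dim (maximizers P l')"
    using ex_minimal_cluster_value by blast
  define k where "k = aff_dim (maximizers P l)"
  obtain g where g: "g > 0" "stable g P l" using polytope_stable[OF polytope] by blast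
  obtain \<epsilon>1 N1 where persist: "\<epsilon>1 > 0" "\<And>n s. n \<ge> N1 \<Longrightarrow> norm (s - u n) \<le> \<epsilon>1 \<Longrightarrow>
      aff_dim (maximizers P s) = k \<Longrightarrow> stable g P s \<Longrightarrow>
      maximizers P s \<inter> \<phi> (w n) ` P \<noteq> {} \<and> aff_dim (maximizers (\<phi> (w n) ` P) s) = k"
    using faces_persist[of k g] l(2) g(1) unfolding k_def by blast
  obtain \<epsilon>0 where usc: "\<epsilon>0 > 0" "\<And>s. norm (s - l) < \<epsilon>0 \<Longrightarrow> maximizers P s \<subseteq> maximizers P l"
    using polytope_maximizers_upper_semicontinuous[OF polytope P_facts(3)] by metis
  obtain N where N: "filterlim N at_top sequentially" "(\<lambda>j. u (N j)) \<longlonglongrightarrow> l"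
    using l(1) by (auto simp: cluster_value_def)
  have close: "\<forall>\<^sub>F j in sequentially. norm (u (N j) - l) < e" if "e > 0" for e
    using tendstoD[OF N(2) that] by (simp add: dist_norm)
  have "\<forall>\<^sub>F j in sequentially. N j \<ge> N1 \<and> norm (u (N j) - l) < Min {\<epsilon>1, g, \<epsilon>0 / 2}"
    using N(1) close[of "Min {\<epsilon>1, g, \<epsilon>0 / 2}"] persist(1) g(1) usc(1)
    by (auto simp: filterlim_at_top eventually_conj_iff)
  then obtain j0 where "N j0 \<ge> N1 \<and> norm (u (N j0) - l) < Min {\<epsilon>1, g, \<epsilon>0 / 2}"
    using eventually_happens'[OF sequentially_bot] by blast
  then obtain n where n: "n \<ge> N1" "norm (u n - l) < \<epsilon>1" "norm (u n - l) < g" "norm (u n - l) < \<epsilon>0 / 2"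
    by auto
  \<comment> \<open>A vector at time \<open>n\<close> as it is seen at time \<open>n + m\<close>.\<close>
  define pull where "pull x = rec_nat x (\<lambda>m. inv (A (w (n + m))))" for x
  have pull_0 [simp]: "pull x 0 = x" for x by (simp add: pull_def)
  have pull_Suc: "A (w (n + m)) (pull x (Suc m)) = pull x m" for x m
    using w by (simp add: pull_def)
  have pull_norm: "norm (pull x m) = norm x" for x m
  proof (induction m)
    case (Suc m)
    then show ?case using A_norm[OF w] pull_Suc by metis
  qed simp
  have u_Suc: "A (w (n + m)) (u (n + Suc m)) = u (n + m)" for m
    using u_step[of "n + m"] by simp
  define s where "s = pull l"
  have s_u: "norm (s m - u (n + m)) = norm (u n - l)" for m
  proof (induction m)
    case 0
    then show ?case by (simp add: s_def norm_minus_commute)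
  next
    case (Suc m)
    have "norm (s (Suc m) - u (n + Suc m)) = norm (A (w (n + m)) (s (Suc m) - u (n + Suc m)))"
      using w by simp
    also have "\<dots> = norm (s m - u (n + m))"
      unfolding A_diff[OF w] u_Suc by (simp add: s_def pull_Suc)
    finally show ?case using Suc by simp
  qed
  have step: "aff_dim (maximizers P (s m)) = k \<and> stable g P (s m)" for m
  proof (induction m)
    case 0
    then show ?case using g by (simp add: s_def k_def)
  next
    case (Suc m)
    let ?i = "w (n + m)"
    note sim = r_pos[OF w[of "n + m"]] orth[OF w[of "n + m"]]
    have As: "A ?i (s (Suc m)) = s m" by (simp add: s_def pull_Suc)
    have *: "maximizers P (s m) \<inter> \<phi> ?i ` P \<noteq> {}" "aff_dim (maximizers (\<phi> ?i ` P) (s m)) = k"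
      using persist(2)[of "n + m" "s m"] s_u[of m] n Suc by auto
    have "stable g (\<phi> ?i ` P) (s m)"
      by (rule stable_subset[OF sub[OF w] *(1)]) (use * Suc in auto)
    then have "stable g P (s (Suc m))" using stable_similarity[OF sim] As by metis
    moreover have "aff_dim (maximizers P (s (Suc m))) = k"
      using maximizers_similarity[OF sim, of "v ?i" P "s (Suc m)"] aff_dim_similarity[OF sim] *(2) As by metis
    ultimately show ?case by blast
  qed
  have face_Suc: "\<phi> (w (n + m)) ` maximizers P (s (Suc m)) = maximizers P (s m) \<inter> \<phi> (w (n + m)) ` P" for m
  proof -
    let ?i = "w (n + m)"
    have "maximizers P (s m) \<inter> \<phi> ?i ` P \<noteq> {}"
      using persist(2)[of "n + m" "s m"] s_u[of m] n step by auto
    then have "maximizers (\<phi> ?i ` P) (s m) = maximizers P (s m) \<inter> \<phi> ?i ` P"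
      by (rule maximizers_subset[OF sub[OF w]])
    then show ?thesis
      using maximizers_similarity[OF r_pos[OF w[of "n + m"]] orth[OF w[of "n + m"]], of "v ?i" P "s (Suc m)"]
      by (simp add: s_def pull_Suc)
  qed
  \<comment> \<open>The height of the face over \<open>b\<close> is divided by the contraction ratio at each step.\<close>
  obtain D where D: "D > 0" "\<And>x y. x \<in> P \<Longrightarrow> y \<in> P \<Longrightarrow> norm (x - y) \<le> D"
    using bounded_norm_diff_le[OF P_facts(4)] by blast
  have norm_s: "norm (s m) = norm l" for m
    by (simp add: s_def pull_norm)
  have height: "s 0 \<bullet> (e - b n) \<le> \<rho> ^ m * (s m \<bullet> (e' - b (n + m)))"
    if "e \<in> maximizers P (s 0)" "e' \<in> maximizers P (s m)" for e e' m
    using that(2)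
  proof (induction m arbitrary: e')
    case 0
    then show ?case using const_onD[OF const_on_maximizers that(1)] by (simp add: inner_diff_right)
  next
    case (Suc m)
    let ?i = "w (n + m)"
    have e': "\<phi> ?i e' \<in> maximizers P (s m)" using face_Suc Suc.prems by blast
    have "\<phi> ?i e' - b (n + m) = r ?i *\<^sub>R A ?i (e' - b (n + Suc m))"
      using b_step[of "n + m"] by (simp add: A_diff[OF w] scaleR_diff_right)
    moreover have "s m \<bullet> A ?i x = s (Suc m) \<bullet> x" for x
      using A_inner[OF w] pull_Suc by (metis s_def)
    ultimately have eq: "s m \<bullet> (\<phi> ?i e' - b (n + m)) = r ?i * (s (Suc m) \<bullet> (e' - b (n + Suc m)))"
      by simp
    have nonneg: "0 \<le> s (Suc m) \<bullet> (e' - b (n + Suc m))"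
      using Suc.prems b_in by (simp add: maximizers_def inner_diff_right)
    have rho0: "0 \<le> \<rho>" using r_pos[OF w[of 0]] r_le[OF w[of 0]] by linarith
    have "s 0 \<bullet> (e - b n) \<le> \<rho> ^ m * (r ?i * (s (Suc m) \<bullet> (e' - b (n + Suc m))))"
      using Suc.IH[OF e'] eq by simp
    also have "\<dots> \<le> \<rho> ^ m * (\<rho> * (s (Suc m) \<bullet> (e' - b (n + Suc m))))"
      using r_le[OF w] nonneg rho0 by (intro mult_left_mono mult_right_mono) auto
    finally show ?case by (simp add: mult_ac)
  qed
  obtain e where e: "e \<in> maximizers P l" using maximizers_nonempty P_facts by blast
  have bn: "b n \<in> maximizers P l"
  proof -
    have rho: "\<bar>\<rho>\<bar> < 1" using r_pos[OF w[of 0]] r_le[OF w[of 0]] rho_less by linarith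
    have "l \<bullet> (e - b n) \<le> \<rho> ^ m * (norm l * D)" for m
    proof -
      obtain e' where e': "e' \<in> maximizers P (s m)" using maximizers_nonempty P_facts by blast
      have "s m \<bullet> (e' - b (n + m)) \<le> norm (s m) * norm (e' - b (n + m))" by (rule norm_cauchy_schwarz)
      also have "\<dots> \<le> norm l * D"
        using D(2)[of e' "b (n + m)"] e' b_in norm_s by (auto intro!: mult_left_mono dest: maximizersD1)
      finally have "\<rho> ^ m * (s m \<bullet> (e' - b (n + m))) \<le> \<rho> ^ m * (norm l * D)"
        using r_pos[OF w[of 0]] r_le[OF w[of 0]] by (intro mult_left_mono) auto
      moreover have "l \<bullet> (e - b n) \<le> \<rho> ^ m * (s m \<bullet> (e' - b (n + m)))"
        using height[of e e' m] e e' by (simp add: s_def)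
      ultimately show ?thesis by linarith
    qed
    moreover have "(\<lambda>m. \<rho> ^ m * (norm l * D)) \<longlonglongrightarrow> 0 * (norm l * D)"
      by (intro tendsto_intros LIMSEQ_power_zero) (use rho in auto)
    ultimately have "l \<bullet> (e - b n) \<le> 0 * (norm l * D)" by (intro LIMSEQ_le_const) auto
    then have "l \<bullet> e \<le> l \<bullet> b n" by (simp add: inner_diff_right)
    then show ?thesis using e b_in[of n] by (auto simp: maximizers_def intro: order_trans)
  qed
  \<comment> \<open>A direction \<open>p\<close> of the face remains a direction of the later faces. At times \<open>N j\<close> these lie
    in the face of \<open>l\<close>, so \<open>l\<close> is orthogonal to \<open>p\<close> and \<open>u\<close>, being close to \<open>l\<close>, nearly so;
    but the inner product of \<open>u\<close> with \<open>p\<close> does not change with time.\<close>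
  have u_const: "u n \<bullet> x = u n \<bullet> y" if x: "x \<in> maximizers P l" and y: "y \<in> maximizers P l" for x y
  proof -
    define p where "p = pull (x - y)"
    have p_norm: "norm (p m) = norm (x - y)" for m
      by (simp add: p_def pull_norm)
    have u_p: "u (n + m) \<bullet> p m = u n \<bullet> (x - y)" for m
    proof (induction m)
      case (Suc m)
      have "u (n + Suc m) \<bullet> p (Suc m) = A (w (n + m)) (u (n + Suc m)) \<bullet> A (w (n + m)) (p (Suc m))"
        using w by simp
      also have "\<dots> = u (n + m) \<bullet> p m" unfolding u_Suc by (simp add: p_def pull_Suc)
      finally show ?case using Suc by simp
    qed (simp add: p_def)
    have p_dir: "z \<bullet> p m = 0" if "const_on z (maximizers P (s m))" for z m
      using that
    proof (induction m arbitrary: z)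
      case 0
      then show ?case using const_onD[OF _ x y] by (simp add: p_def s_def inner_diff_right)
    next
      case (Suc m)
      let ?i = "w (n + m)"
      note sim = r_pos[OF w[of "n + m"]] orth[OF w[of "n + m"]]
      have "const_on (A ?i z) (\<phi> ?i ` maximizers P (s (Suc m)))"
        using Suc.prems const_on_similarity[OF sim] by blast
      moreover have "aff_dim (\<phi> ?i ` maximizers P (s (Suc m))) = aff_dim (maximizers P (s m))"
        using aff_dim_similarity[OF sim] step by simp
      moreover have "\<phi> ?i ` maximizers P (s (Suc m)) \<noteq> {}"
        using maximizers_nonempty P_facts by blast
      ultimately have "const_on (A ?i z) (maximizers P (s m))"
        using const_on_aff_dim_eq face_Suc by (metis inf_le1)
      then have "A ?i z \<bullet> p m = 0" by (rule Suc.IH)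
      moreover have "p m = A ?i (p (Suc m))" by (simp add: p_def pull_Suc)
      ultimately show ?case using w by simp
    qed
    have "\<forall>\<^sub>F j in sequentially. \<bar>u n \<bullet> (x - y)\<bar> \<le> norm (u (N j) - l) * norm (x - y)"
    proof -
      have "\<forall>\<^sub>F j in sequentially. N j \<ge> n \<and> norm (u (N j) - l) < \<epsilon>0 / 2"
        using N(1) close[of "\<epsilon>0 / 2"] usc(1) by (auto simp: filterlim_at_top eventually_conj_iff)
      then show ?thesis
      proof (rule eventually_mono)
        fix j assume j: "N j \<ge> n \<and> norm (u (N j) - l) < \<epsilon>0 / 2"
        define m where "m = N j - n"
        have m: "N j = n + m" using j by (simp add: m_def)
        have "norm (s m - l) \<le> norm (s m - u (n + m)) + norm (u (n + m) - l)"
          using norm_triangle_ineq[of "s m - u (n + m)" "u (n + m) - l"] by simp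
        then have "norm (s m - l) < \<epsilon>0" using j m s_u[of m] n(4) by simp
        then have "maximizers P (s m) \<subseteq> maximizers P l" by (rule usc(2))
        then have "const_on l (maximizers P (s m))"
          using const_on_maximizers[of l P] unfolding const_on_def by blast
        then have "l \<bullet> p m = 0" by (rule p_dir)
        then have "u n \<bullet> (x - y) = (u (n + m) - l) \<bullet> p m" using u_p[of m] by (simp add: inner_diff_left)
        then show "\<bar>u n \<bullet> (x - y)\<bar> \<le> norm (u (N j) - l) * norm (x - y)"
          using Cauchy_Schwarz_ineq2[of "u (n + m) - l" "p m"] p_norm m by simp
      qed
    qed
    moreover have "(\<lambda>j. norm (u (N j) - l) * norm (x - y)) \<longlonglongrightarrow> norm (l - l) * norm (x - y)"
      by (intro tendsto_intros N(2))
    ultimately have "\<bar>u n \<bullet> (x - y)\<bar> \<le> norm (l - l) * norm (x - y)"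
      using tendsto_lowerbound sequentially_bot by blast
    then show ?thesis by (simp add: inner_diff_right)
  qed
  have "const_on (u n - l) (maximizers P l)"
    unfolding const_on_def inner_diff_left
    using u_const const_onD[OF const_on_maximizers] by metis
  then have "maximizers P l \<subseteq> maximizers P (l + (u n - l))"
    using g(2) n(3) unfolding stable_def by (meson less_imp_le)
  then show ?thesis using bn by auto
qed

end

section \<open>Pieces of a self-similar set\<close>

definition word_map :: "('i \<Rightarrow> 'a \<Rightarrow> 'a) \<Rightarrow> 'i list \<Rightarrow> 'a \<Rightarrow> 'a" where
  "word_map f xs = foldr (\<lambda>i h. f i \<circ> h) xs id"

lemma word_map_Nil [simp]: "word_map f [] = id"
  by (simp add: word_map_def)

lemma word_map_snoc: "word_map f (xs @ [i]) = word_map f xs \<circ> f i"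
proof -
  have "foldr (\<lambda>i h. f i \<circ> h) xs g = foldr (\<lambda>i h. f i \<circ> h) xs id \<circ> g" for g
    by (induction xs) (simp_all add: o_assoc)
  then show ?thesis by (simp add: word_map_def)
qed

text \<open>The points of \<open>K\<close> lie outside the ball around \<open>x\<close> through \<open>a\<close>, whose boundary is tangent to a
hyperplane at \<open>a\<close>; near \<open>a\<close> the two differ only to second order.\<close>

lemma nearest_points_inner_le:
  assumes "a \<in> nearest_points K x" "z \<in> K"
  shows "(x - a) \<bullet> (z - a) \<le> (norm (z - a))\<^sup>2 / 2"
proof -
  have "dist x a \<le> dist x z"
    using assms infdist_le[OF assms(2), of x] by (simp add: nearest_points_def)
  then have "(norm (x - a))\<^sup>2 \<le> (norm (x - z))\<^sup>2" by (simp add: dist_norm power_mono)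
  moreover have "x - z = (x - a) - (z - a)" by simp
  ultimately have "(norm (x - a))\<^sup>2 \<le> (norm ((x - a) - (z - a)))\<^sup>2" by metis
  moreover have expand: "(norm (p - q))\<^sup>2 = (norm p)\<^sup>2 - 2 * (p \<bullet> q) + (norm q)\<^sup>2" for p q :: 'a
    by (simp add: power2_norm_eq_inner inner_diff_left inner_diff_right inner_commute[of q p])
  ultimately show ?thesis using expand[of "x - a" "z - a"] by linarith
qed

lemma convex_hull_similarity:
  fixes A :: "'a::euclidean_space \<Rightarrow> 'a"
  assumes "linear A"
  shows "(\<lambda>x. r *\<^sub>R A x + v) ` (convex hull S) = convex hull ((\<lambda>x. r *\<^sub>R A x + v) ` S)"
proof -
  have lin: "linear (\<lambda>x. r *\<^sub>R A x)" using assms linear_compose_scale_right by blast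
  have *: "(\<lambda>x. r *\<^sub>R A x + v) ` T = (\<lambda>x. v + x) ` ((\<lambda>x. r *\<^sub>R A x) ` T)" for T
    by (auto simp: image_image add.commute)
  show ?thesis
    unfolding * convex_hull_translation convex_hull_linear_image[OF lin] ..
qed

text \<open>On a piece of scale \<open>c\<close> the ball condition allows an excess over the tangent hyperplane of order
\<open>c\<^sup>2\<close>. Rescaled to unit size this is of order \<open>c\<close> and tends to \<open>0\<close>, as
\<open>support_attained\<close> requires.\<close>

lemma nearest_point_supports_piece:
  fixes K :: "'a::euclidean_space set"
  assumes K: "compact K" "polytope (convex hull K)" and I: "finite I" "\<And>i. i \<in> I \<Longrightarrow> contracting_similarity (f i)"
    and self: "K = (\<Union>i\<in>I. f i ` K)" and a: "a \<in> nearest_points K x"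
  obtains xs where "a \<in> maximizers (word_map f xs ` (convex hull K)) (x - a)"
proof -
  define P where "P = convex hull K"
  have aK: "a \<in> K" using a by (simp add: nearest_points_def)
  have "\<forall>i\<in>I. \<exists>r A v. 0 < r \<and> r < 1 \<and> orthogonal_transformation A \<and> f i = (\<lambda>x. r *\<^sub>R A x + v)"
    using I(2) by (fastforce simp: contracting_similarity_def)
  then obtain r A v where sim: "\<And>i. i \<in> I \<Longrightarrow> 0 < r i" "\<And>i. i \<in> I \<Longrightarrow> r i < 1"
    "\<And>i. i \<in> I \<Longrightarrow> orthogonal_transformation (A i)" "\<And>i. i \<in> I \<Longrightarrow> f i = (\<lambda>x. r i *\<^sub>R A i x + v i)"
    by metis
  define \<rho> where "\<rho> = Max (r ` I)"
  have ne: "I \<noteq> {}" using self aK by blast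
  have rho: "\<rho> < 1" "\<And>i. i \<in> I \<Longrightarrow> r i \<le> \<rho>" using sim(2) I(1) ne by (auto simp: \<rho>_def)
  \<comment> \<open>Choose a first digit for each point of \<open>K\<close>; iteration yields an address of \<open>a\<close>.\<close>
  have "\<forall>y\<in>K. \<exists>i c. i \<in> I \<and> c \<in> K \<and> y = f i c" using self by blast
  then obtain dig tail where code: "\<And>y. y \<in> K \<Longrightarrow> dig y \<in> I" "\<And>y. y \<in> K \<Longrightarrow> tail y \<in> K"
    "\<And>y. y \<in> K \<Longrightarrow> y = f (dig y) (tail y)" by metis
  define b where "b n = (tail ^^ n) a" for n
  define w where "w n = dig (b n)" for n
  have bK: "b n \<in> K" for n by (induction n) (use aK code(2) in \<open>auto simp: b_def\<close>)
  have w: "w n \<in> I" for n using code(1) bK by (simp add: w_def)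
  have b_f: "b n = f (w n) (b (Suc n))" for n using code(3)[OF bK[of n]] by (simp add: w_def b_def)
  define u where "u = rec_nat (x - a) (\<lambda>n. inv (A (w n)))"
  have u_step: "u n = A (w n) (u (Suc n))" for n
    using surj_f_inv_f[OF orthogonal_transformation_surj[OF sim(3)[OF w]]] by (simp add: u_def)
  define \<Phi> where "\<Phi> n = word_map f (map w [0..<n])" for n
  have Phi_Suc: "\<Phi> (Suc n) = \<Phi> n \<circ> f (w n)" for n by (simp add: \<Phi>_def word_map_snoc)
  have Phi_b: "\<Phi> n (b n) = a" for n
  proof (induction n)
    case (Suc n)
    then show ?case using b_f[of n] by (simp add: Phi_Suc)
  qed (simp add: \<Phi>_def b_def)
  have Phi_K: "\<Phi> n y \<in> K" if "y \<in> K" for n y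
    using that
  proof (induction n arbitrary: y)
    case (Suc n)
    then show ?case using self w by (auto simp: Phi_Suc)
  qed (simp add: \<Phi>_def)
  have Phi: "\<exists>c Q. 0 < c \<and> c \<le> \<rho> ^ n \<and> orthogonal_transformation Q \<and> Q (u n) = x - a \<and>
    (\<forall>y y'. \<Phi> n y - \<Phi> n y' = c *\<^sub>R Q (y - y'))" for n
  proof (induction n)
    case 0
    show ?case
      by (rule exI[of _ 1], rule exI[of _ id]) (simp add: \<Phi>_def u_def orthogonal_transformation_id[unfolded id_def] id_def)
  next
    case (Suc n)
    then obtain c Q where c: "0 < c" "c \<le> \<rho> ^ n" "orthogonal_transformation Q" "Q (u n) = x - a"
      "\<And>y y'. \<Phi> n y - \<Phi> n y' = c *\<^sub>R Q (y - y')" by blast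
    have "\<Phi> (Suc n) y - \<Phi> (Suc n) y' = (c * r (w n)) *\<^sub>R (Q \<circ> A (w n)) (y - y')" for y y'
    proof -
      have lin: "linear Q" "linear (A (w n))"
        using orthogonal_transformation_linear[OF c(3)] orthogonal_transformation_linear[OF sim(3)[OF w]] .
      have "f (w n) y - f (w n) y' = r (w n) *\<^sub>R A (w n) (y - y')"
        by (simp add: sim(4)[OF w] linear_diff[OF lin(2)] scaleR_diff_right)
      then have "\<Phi> (Suc n) y - \<Phi> (Suc n) y' = c *\<^sub>R Q (r (w n) *\<^sub>R A (w n) (y - y'))"
        by (simp only: Phi_Suc o_apply c(5))
      then show ?thesis by (simp only: linear_scale[OF lin(1)] scaleR_scaleR o_apply)
    qed
    moreover have "c * r (w n) \<le> \<rho> ^ Suc n"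
      using c(1,2) sim(1)[OF w[of n]] rho(2)[OF w[of n]] by (simp add: mult.commute[of \<rho>] mult_mono)
    moreover have "0 < c * r (w n)" using c(1) sim(1)[OF w] by simp
    moreover have "orthogonal_transformation (Q \<circ> A (w n))"
      using orthogonal_transformation_compose[OF c(3) sim(3)[OF w]] .
    moreover have "(Q \<circ> A (w n)) (u (Suc n)) = x - a" using c(4) u_step[of n] by simp
    ultimately show ?case by blast
  qed
  obtain D where D: "D > 0" "\<And>x y. x \<in> K \<Longrightarrow> y \<in> K \<Longrightarrow> norm (x - y) \<le> D"
    using bounded_norm_diff_le[OF compact_imp_bounded[OF K(1)]] by blast
  have small: "u n \<bullet> (y - b n) \<le> \<rho> ^ n * (D\<^sup>2 / 2)" if y: "y \<in> P" for y n
  proof -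
    obtain c Q where c: "0 < c" "c \<le> \<rho> ^ n" "orthogonal_transformation Q" "Q (u n) = x - a"
      "\<And>y y'. \<Phi> n y - \<Phi> n y' = c *\<^sub>R Q (y - y')" using Phi[of n] by blast
    have "K \<subseteq> {z. u n \<bullet> z \<le> \<rho> ^ n * (D\<^sup>2 / 2) + u n \<bullet> b n}"
    proof
      fix z assume z: "z \<in> K"
      have eq: "\<Phi> n z - a = c *\<^sub>R Q (z - b n)" using c(5)[of z "b n"] Phi_b by simp
      have "(x - a) \<bullet> (\<Phi> n z - a) \<le> (norm (\<Phi> n z - a))\<^sup>2 / 2"
        by (rule nearest_points_inner_le[OF a Phi_K[OF z]])
      moreover have "(x - a) \<bullet> Q (z - b n) = u n \<bullet> (z - b n)"
        using c(3) unfolding c(4)[symmetric] by (simp add: orthogonal_transformation_def)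
      moreover have "norm (Q (z - b n)) = norm (z - b n)"
        using c(3) orthogonal_transformation_norm by blast
      ultimately have "c * (u n \<bullet> (z - b n)) \<le> c * (c * (norm (z - b n))\<^sup>2 / 2)"
        by (simp add: eq power_mult_distrib power2_eq_square mult_ac)
      then have "u n \<bullet> (z - b n) \<le> c * (norm (z - b n))\<^sup>2 / 2" using c(1) by simp
      also have "\<dots> \<le> \<rho> ^ n * D\<^sup>2 / 2"
        using c(1,2) D(2)[OF z bK[of n]] by (intro divide_right_mono mult_mono power_mono) auto
      finally show "z \<in> {z. u n \<bullet> z \<le> \<rho> ^ n * (D\<^sup>2 / 2) + u n \<bullet> b n}" by (simp add: inner_diff_right)
    qed
    then have "P \<subseteq> {z. u n \<bullet> z \<le> \<rho> ^ n * (D\<^sup>2 / 2) + u n \<bullet> b n}"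
      unfolding P_def by (rule hull_minimal) (rule convex_halfspace_le)
    then show ?thesis using y by (auto simp: inner_diff_right)
  qed
  have rho_abs: "\<bar>\<rho>\<bar> < 1" using rho(1) rho(2)[OF w[of 0]] sim(1)[OF w[of 0]] by linarith
  interpret similarity_orbit P I r A v \<rho> w b u
  proof
    show "polytope P" using K(2) by (simp add: P_def)
    show "(\<lambda>x. r i *\<^sub>R A i x + v i) ` P \<subseteq> P" if "i \<in> I" for i
    proof -
      have "f i ` P = convex hull (f i ` K)"
        unfolding P_def sim(4)[OF that]
        by (rule convex_hull_similarity[OF orthogonal_transformation_linear[OF sim(3)[OF that]]])
      also have "\<dots> \<subseteq> P" unfolding P_def by (rule hull_mono) (use self that in blast)
      finally show ?thesis unfolding sim(4)[OF that] .
    qed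
    show "b n \<in> P" for n using bK unfolding P_def by (rule hull_inc)
    show "b n = r (w n) *\<^sub>R A (w n) (b (Suc n)) + v (w n)" for n
      using b_f[of n] sim(4)[OF w[of n]] by metis
    fix \<epsilon> :: real assume "\<epsilon> > 0"
    have "(\<lambda>n. \<rho> ^ n * (D\<^sup>2 / 2)) \<longlonglongrightarrow> 0 * (D\<^sup>2 / 2)"
      by (intro tendsto_intros LIMSEQ_power_zero) (use rho_abs in auto)
    then have "\<forall>\<^sub>F n in sequentially. \<rho> ^ n * (D\<^sup>2 / 2) < \<epsilon>"
      by (rule order_tendstoD(2)) (use \<open>\<epsilon> > 0\<close> in simp)
    then show "\<exists>N. \<forall>n\<ge>N. \<forall>y\<in>P. u n \<bullet> (y - b n) \<le> \<epsilon>"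
      unfolding eventually_sequentially using small by (meson less_le_not_le order_trans)
  qed (fact I(1) sim rho w u_step)+
  obtain n where n: "b n \<in> maximizers P (u n)" using support_attained by blast
  obtain c Q where c: "0 < c" "orthogonal_transformation Q" "Q (u n) = x - a"
    "\<And>y y'. \<Phi> n y - \<Phi> n y' = c *\<^sub>R Q (y - y')" using Phi[of n] by blast
  have "(x - a) \<bullet> \<Phi> n y \<le> (x - a) \<bullet> a" if "y \<in> P" for y
  proof -
    have "\<Phi> n y - a = c *\<^sub>R Q (y - b n)" using c(4)[of y "b n"] Phi_b by simp
    moreover have "(x - a) \<bullet> Q (y - b n) = u n \<bullet> (y - b n)"
      using c(2) unfolding c(3)[symmetric] by (simp add: orthogonal_transformation_def)
    moreover have "u n \<bullet> (y - b n) \<le> 0" using n that by (simp add: maximizers_def inner_diff_right)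
    ultimately have "(x - a) \<bullet> (\<Phi> n y - a) \<le> 0" using c(1) by (simp add: mult_nonneg_nonpos)
    then show ?thesis by (simp add: inner_diff_right)
  qed
  moreover have "a \<in> \<Phi> n ` P" using Phi_b[of n] b_in by (metis imageI)
  ultimately have "a \<in> maximizers (\<Phi> n ` P) (x - a)" by (auto simp: maximizers_def)
  then show ?thesis using that unfolding \<Phi>_def P_def by blast
qed

text \<open>What a critical point of value \<open>d\<close> with supported pieces \<open>\<W>\<close> provides. Every member of
\<open>\<W>\<close> has to be touched, so that two critical points with the same \<open>\<W>\<close> can be compared.\<close>

definition witness :: "'a::euclidean_space set set \<Rightarrow> real \<Rightarrow> bool" where
  "witness \<W> d \<longleftrightarrow> 0 \<le> d \<and> (\<exists>x S. x \<in> convex hull S \<and> (\<forall>a\<in>S. dist x a = d) \<and>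
     (\<forall>a\<in>S. \<exists>Q\<in>\<W>. a \<in> maximizers Q (x - a)) \<and> (\<forall>Q\<in>\<W>. \<exists>a\<in>S. a \<in> Q))"

text \<open>For each \<open>a\<close> in \<open>S\<close> pick \<open>a'\<close> in \<open>S'\<close> on the same piece. As the piece is supported at \<open>a\<close>,
\<open>(x - a) \<bullet> (x' - x) + d\<^sup>2 \<le> (x - a) \<bullet> (x' - a') \<le> d * d'\<close>. This bound is affine in \<open>a\<close>, so it
holds at \<open>a = x\<close>, where it reads \<open>d\<^sup>2 \<le> d * d'\<close>.\<close>

lemma witness_le:
  assumes "witness \<W> d" "witness \<W> d'"
  shows "d \<le> d'"
proof -
  obtain x S where x: "x \<in> convex hull S" "\<And>a. a \<in> S \<Longrightarrow> dist x a = d"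
    "\<And>a. a \<in> S \<Longrightarrow> \<exists>Q\<in>\<W>. a \<in> maximizers Q (x - a)"
    using assms(1) unfolding witness_def by blast
  obtain x' S' where x': "\<And>a. a \<in> S' \<Longrightarrow> dist x' a = d'" "\<And>Q. Q \<in> \<W> \<Longrightarrow> \<exists>a\<in>S'. a \<in> Q"
    using assms(2) unfolding witness_def by blast
  have "S \<subseteq> {a. (x - x') \<bullet> a \<le> d * d' - d\<^sup>2 + (x - x') \<bullet> x}"
  proof
    fix a assume a: "a \<in> S"
    then obtain Q where Q: "Q \<in> \<W>" "a \<in> maximizers Q (x - a)" using x(3) by blast
    then obtain a' where a': "a' \<in> S'" "a' \<in> Q" using x'(2) by blast
    have "(x - a) \<bullet> a' \<le> (x - a) \<bullet> a" using Q(2) a'(2) by (simp add: maximizers_def)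
    moreover have "(x - a) \<bullet> (x' - a') \<le> d * d'"
      using norm_cauchy_schwarz[of "x - a" "x' - a'"] x(2)[OF a] x'(1)[OF a'(1)] by (simp add: dist_norm)
    moreover have "(x - a) \<bullet> (x - a) = d\<^sup>2"
      using x(2)[OF a] by (simp add: dist_norm power2_norm_eq_inner[symmetric])
    ultimately show "a \<in> {a. (x - x') \<bullet> a \<le> d * d' - d\<^sup>2 + (x - x') \<bullet> x}"
      by (simp add: inner_diff_left inner_diff_right inner_commute)
  qed
  then have "convex hull S \<subseteq> {a. (x - x') \<bullet> a \<le> d * d' - d\<^sup>2 + (x - x') \<bullet> x}"
    by (rule hull_minimal) (rule convex_halfspace_le)
  then have "d * d \<le> d * d'" using x(1) by (auto simp: power2_eq_square)
  then show ?thesis using assms unfolding witness_def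
    by (cases "d = 0") auto
qed

theorem theorem3p1:
  fixes K :: "(real ^ 'n) set"
  assumes "self_similar K"
    and "polytope (convex hull K)"
  shows "countable (critical_values K)"
proof -
  obtain k :: nat and f where f: "\<And>i. i \<in> {1..k} \<Longrightarrow> contracting_similarity (f i)"
    "K = (\<Union>i\<in>{1..k}. f i ` K)" and K: "compact K"
    using assms(1) unfolding self_similar_def by blast
  define pieces where "pieces = range (\<lambda>xs. word_map f xs ` (convex hull K))"
  have "\<exists>\<W>. finite \<W> \<and> \<W> \<subseteq> pieces \<and> witness \<W> d" if "d \<in> critical_values K" for d
  proof -
    obtain x where x: "d = infdist x K" "x \<in> convex hull (nearest_points K x)"
      using \<open>d \<in> critical_values K\<close> by (auto simp: critical_values_def critical_point_def)
    obtain S where S: "finite S" "S \<subseteq> nearest_points K x" "x \<in> convex hull S"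
      using x(2) unfolding caratheodory[of "nearest_points K x"] by blast
    have "\<exists>Q\<in>pieces. a \<in> maximizers Q (x - a)" if "a \<in> S" for a
    proof -
      have "a \<in> nearest_points K x" using that S(2) by blast
      from nearest_point_supports_piece[OF K assms(2) _ f this]
      show ?thesis unfolding pieces_def by blast
    qed
    then obtain piece where piece: "\<And>a. a \<in> S \<Longrightarrow> piece a \<in> pieces \<and> a \<in> maximizers (piece a) (x - a)"
      by metis
    have "dist x a = d" if "a \<in> S" for a using S(2) that x(1) by (auto simp: nearest_points_def)
    then have "witness (piece ` S) d"
      unfolding witness_def using S(3) x(1) piece
      by (intro conjI exI[of _ x] exI[of _ S]) (auto simp: infdist_nonneg dest: maximizersD1)
    then show ?thesis using S(1) piece by (intro exI[of _ "piece ` S"]) auto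
  qed
  then have "\<forall>d\<in>critical_values K. \<exists>\<W>. \<W> \<in> {X. finite X \<and> X \<subseteq> pieces} \<and> witness \<W> d"
    by blast
  from bchoice[OF this] obtain \<W> where \<W>: "\<And>d. d \<in> critical_values K \<Longrightarrow> \<W> d \<in> {X. finite X \<and> X \<subseteq> pieces}"
    "\<And>d. d \<in> critical_values K \<Longrightarrow> witness (\<W> d) d" by blast
  have "inj_on \<W> (critical_values K)"
    by (rule inj_onI) (metis \<W>(2) witness_le order_antisym)
  moreover have "countable {X. finite X \<and> X \<subseteq> pieces}"
    using countable_Collect_finite_subset[of pieces] by (simp add: pieces_def)
  then have "countable (\<W> ` critical_values K)"
    by (rule countable_subset[rotated]) (use \<W>(1) in blast)
  ultimately show ?thesis by (meson countable_image_inj_on)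
qed

end
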